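(* Let $E_1,\dots,E_m,F$ be Banach spaces. Let $\mathfrak{P}$ be a property of continuous $(m-k)$-linear operators from $E_1\times\stackrel{[p_1,\dots,p_k]}{\cdots}\times E_m$ to $F$, where $0\le k\le m-1$ and $p_1<\cdots<p_k$ in $\{1,\dots,m\}$, such that, for all such $k,p_1,\dots,p_k$, $$\{B\in\mathcal{L}(E_1,\stackrel{[p_1,\dots,p_k]}{\dots},E_m;F) : B\text{ has }\mathfrak{P}\}$$ is a closed subspace of $\mathcal{L}(E_1,\stackrel{[p_1,\dots,p_k]}{\dots},E_m;F)$. Then the set of continuous $m$-linear operators $A\colon E_1\times\cdots\times E_m\to F$ having property $\mathfrak{P}$ strongly is a closed subspace of $\mathcal{L}(E_1,\dots,E_m;F)$.
   Context: The symbol $\stackrel{[p_1,\dots,p_k]}{\dots}$ means that the coordinates $p_1,\dots,p_k$ are omitted (none if $k=0$). Spaces $\mathcal{L}(\cdot;F)$ of continuous multilinear operators carry the usual sup norm. Given an $m$-linear operator $A\colon E_1\times\cdots\times E_m\to F$, $0\le k\le m-1$, $p_1<\cdots<p_k$ in $\{1,\dots,m\}$ and $a_{p_1}\in E_{p_1},\dots,a_{p_k}\in E_{p_k}$, the resulting operator $A_{a_{p_1},\dots,a_{p_k}}\colon E_1\times\stackrel{[p_1,\dots,p_k]}{\cdots}\times E_m\to F$ is the $(m-k)$-linear operator obtained from $A$ by fixing the $p_j$-th variable equal to $a_{p_j}$ for $j=1,\dots,k$ (for $k=0$ it is $A$ itself). $A$ has property $\mathfrak{P}$ strongly if all resulting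 operators $A_{a_{p_1},\dots,a_{p_k}}$, for all such $k$, $p_1<\cdots<p_k$ and $a_{p_j}\in E_{p_j}$, have property $\mathfrak{P}$. *)

theory Defs
  imports "HOL-Analysis.Analysis" "HOL-Algebra.Algebraic_Closure_Type"
begin

text \<open>
  The spaces \<open>E\<^sub>1, \<dots>, E\<^sub>m, F\<close> are different Banach spaces and \<open>m\<close> is arbitrary, so normed spaces are
  records with an explicit carrier, extending the modules of HOL-Algebra. The \<open>mult\<close> and \<open>one\<close>
  fields that these inherit from rings play no role.

  The scalars are a type \<open>'k\<close> of class \<open>real_normed_field\<close>, which covers \<open>real\<close> and \<open>complex\<close>.
\<close>

record ('k, 'a) normed_module = "('k, 'a) module" +
  vnorm :: "'a \<Rightarrow> real"

abbreviation scalars :: "'k::real_normed_field ring" where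
  "scalars \<equiv> ring_of_type_algebra"

locale normed_space = module scalars V
  for V :: "('k::real_normed_field, 'a, 'c) normed_module_scheme" (structure) +
  assumes vnorm_eq_zero_iff: "x \<in> carrier V \<Longrightarrow> vnorm V x = 0 \<longleftrightarrow> x = \<zero>\<^bsub>V\<^esub>"
    and vnorm_triangle:
      "\<lbrakk>x \<in> carrier V; y \<in> carrier V\<rbrakk> \<Longrightarrow> vnorm V (x \<oplus>\<^bsub>V\<^esub> y) \<le> vnorm V x + vnorm V y"
    and vnorm_smult: "x \<in> carrier V \<Longrightarrow> vnorm V (c \<odot>\<^bsub>V\<^esub> x) = norm c * vnorm V x"

text \<open>
  The distance is cut off outside the carrier because \<^locale>\<open>Metric_space\<close> demands nonnegativity
  and symmetry of the distance on the whole type.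
\<close>

definition vdist :: "('k, 'a, 'c) normed_module_scheme \<Rightarrow> 'a \<Rightarrow> 'a \<Rightarrow> real" where
  "vdist V x y = (if x \<in> carrier V \<and> y \<in> carrier V then vnorm V (x \<ominus>\<^bsub>V\<^esub> y) else 0)"

definition vtopology :: "('k, 'a, 'c) normed_module_scheme \<Rightarrow> 'a topology" where
  "vtopology V = Metric_space.mtopology (carrier V) (vdist V)"

locale banach_space = normed_space +
  assumes complete: "Metric_space.mcomplete (carrier V) (vdist V)"

definition closed_subspace ::
    "('k::real_normed_field, 'a, 'c) normed_module_scheme \<Rightarrow> 'a set \<Rightarrow> bool" where
  "closed_subspace V S \<longleftrightarrow> submodule S scalars V \<and> closedin (vtopology V) S"

text \<open>
  A point of the product of the \<open>E i\<close>, \<open>i \<in> I\<close>, is an extensional function on \<open>I\<close>, and an operator on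
  this product is an extensional function on the set of these points. An omitted coordinate is one
  missing from \<open>I\<close>; the other coordinates keep their indices.
\<close>

definition points :: "'i set \<Rightarrow> ('i \<Rightarrow> ('k, 'a) normed_module) \<Rightarrow> ('i \<Rightarrow> 'a) set" where
  "points I E = (\<Pi>\<^sub>E i\<in>I. carrier (E i))"

definition multilinear ::
    "'i set \<Rightarrow> ('i \<Rightarrow> ('k, 'a) normed_module) \<Rightarrow> ('k, 'b) normed_module \<Rightarrow> (('i \<Rightarrow> 'a) \<Rightarrow> 'b) \<Rightarrow> bool" where
  "multilinear I E F A \<longleftrightarrow>
     A \<in> points I E \<rightarrow>\<^sub>E carrier F \<and>
     (\<forall>x\<in>points I E. \<forall>i\<in>I. \<forall>u\<in>carrier (E i). \<forall>v\<in>carrier (E i).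
        A (x(i := u \<oplus>\<^bsub>E i\<^esub> v)) = A (x(i := u)) \<oplus>\<^bsub>F\<^esub> A (x(i := v))) \<and>
     (\<forall>x\<in>points I E. \<forall>i\<in>I. \<forall>c. \<forall>u\<in>carrier (E i).
        A (x(i := c \<odot>\<^bsub>E i\<^esub> u)) = c \<odot>\<^bsub>F\<^esub> A (x(i := u)))"

text \<open>The space \<open>\<L>(E i, i \<in> I; F)\<close> with the pointwise operations and the sup norm.\<close>

definition multilinear_space ::
    "'i set \<Rightarrow> ('i \<Rightarrow> ('k, 'a) normed_module) \<Rightarrow> ('k, 'b) normed_module
      \<Rightarrow> ('k, ('i \<Rightarrow> 'a) \<Rightarrow> 'b) normed_module" where
  "multilinear_space I E F =
     \<lparr>carrier = {A. multilinear I E F A \<and>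
        continuous_map (product_topology (\<lambda>i. vtopology (E i)) I) (vtopology F) A},
      monoid.mult = undefined,
      one = undefined,
      zero = (\<lambda>x\<in>points I E. \<zero>\<^bsub>F\<^esub>),
      add = (\<lambda>A B. \<lambda>x\<in>points I E. A x \<oplus>\<^bsub>F\<^esub> B x),
      smult = (\<lambda>c A. \<lambda>x\<in>points I E. c \<odot>\<^bsub>F\<^esub> A x),
      vnorm = (\<lambda>A. SUP x\<in>{x \<in> points I E. \<forall>i\<in>I. vnorm (E i) (x i) \<le> 1}. vnorm F (A x))\<rparr>"

text \<open>Fixing the variables of \<open>A\<close> with indices in \<open>J\<close> to the values given by \<open>a \<in> points J E\<close>.\<close>

definition resulting ::
    "'i set \<Rightarrow> ('i \<Rightarrow> ('k, 'a) normed_module) \<Rightarrow> (('i \<Rightarrow> 'a) \<Rightarrow> 'b) \<Rightarrow> 'i set \<Rightarrow> ('i \<Rightarrow> 'a)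
      \<Rightarrow> (('i \<Rightarrow> 'a) \<Rightarrow> 'b)" where
  "resulting I E A J a = (\<lambda>x\<in>points (I - J) E. A (override_on x a J))"

text \<open>
  The indices \<open>p\<^sub>1 < \<dots> < p\<^sub>k\<close> with \<open>0 \<le> k \<le> m - 1\<close> are given by the set \<open>J = {p\<^sub>1, \<dots>, p\<^sub>k}\<close>, which is an
  arbitrary proper subset of \<open>I = {1..m}\<close>. A property may depend on the space to which the operator
  belongs, hence the argument \<open>J\<close> of \<open>P\<close>.
\<close>

definition has_strongly ::
    "'i set \<Rightarrow> ('i \<Rightarrow> ('k, 'a) normed_module) \<Rightarrow> ('i set \<Rightarrow> (('i \<Rightarrow> 'a) \<Rightarrow> 'b) \<Rightarrow> bool)
      \<Rightarrow> (('i \<Rightarrow> 'a) \<Rightarrow> 'b) \<Rightarrow> bool" where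
  "has_strongly I E P A \<longleftrightarrow> (\<forall>J. J \<subset> I \<longrightarrow> (\<forall>a\<in>points J E. P J (resulting I E A J a)))"

end

theory Submission
  imports Defs
begin

text \<open>
  Fixing the variables with indices in \<open>J\<close> to the values \<open>a\<close> is a linear map
  \<open>R\<^sub>J\<^sub>,\<^sub>a\<close> from \<open>\<L>(E i, i \<in> I; F)\<close> to \<open>\<L>(E i, i \<in> I - J; F)\<close>, and it is bounded:
  \<open>\<parallel>R\<^sub>J\<^sub>,\<^sub>a A\<parallel> \<le> (\<Prod>j\<in>J. \<parallel>a j\<parallel>) * \<parallel>A\<parallel>\<close>. An operator \<open>A\<close> has the property strongly exactly when every
  \<open>R\<^sub>J\<^sub>,\<^sub>a A\<close> has it, so the operators in question form the intersection, over all \<open>J\<close> and \<open>a\<close>, of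
  the preimages under \<open>R\<^sub>J\<^sub>,\<^sub>a\<close> of subspaces that are closed by hypothesis. A preimage of a closed
  subspace under a bounded linear map is a closed subspace (\<open>closed_subspace_vimage\<close>), and so is an
  intersection of closed subspaces (\<open>closed_subspace_Inter\<close>).

  Most of the work lies in showing that the sup norm really makes the continuous multilinear
  operators into a normed space (\<open>normed_space_multilinear\<close>); otherwise its distance would not be
  known to be a metric and nothing could be said about its topology. The key is that a continuous
  multilinear operator is bounded on the unit ball (\<open>multilinear_space_bounded\<close>). Rescaling every
  coordinate then gives \<open>\<parallel>A x\<parallel> \<le> \<parallel>A\<parallel> * (\<Prod>i\<in>I. \<parallel>x i\<parallel>)\<close> (\<open>vnorm_eval\<close>), from which both the
  definiteness of the norm and the bound on \<open>R\<^sub>J\<^sub>,\<^sub>a\<close> follow.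
\<close>

section \<open>Normed spaces with an explicit carrier\<close>

lemma scalars_simps [simp]:
  "carrier (scalars :: 'k::real_normed_field ring) = UNIV"
  "a \<oplus>\<^bsub>scalars\<^esub> b = (a + b :: 'k)"
  "a \<otimes>\<^bsub>scalars\<^esub> b = a * b"
  "\<zero>\<^bsub>scalars\<^esub> = (0 :: 'k)"
  "\<one>\<^bsub>scalars\<^esub> = (1 :: 'k)"
  by (simp_all add: ring_of_type_algebra_def)

context normed_space
begin

lemma smult_carrier [simp]: "x \<in> carrier V \<Longrightarrow> c \<odot>\<^bsub>V\<^esub> x \<in> carrier V"
  by (rule smult_closed) simp

lemma smult_zero_left [simp]: "x \<in> carrier V \<Longrightarrow> 0 \<odot>\<^bsub>V\<^esub> x = \<zero>\<^bsub>V\<^esub>"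
  using smult_l_null by simp

lemma smult_zero_right [simp]: "c \<odot>\<^bsub>V\<^esub> \<zero>\<^bsub>V\<^esub> = \<zero>\<^bsub>V\<^esub>"
  using smult_r_null by simp

lemma smult_1 [simp]: "x \<in> carrier V \<Longrightarrow> 1 \<odot>\<^bsub>V\<^esub> x = x"
  using smult_one by simp

lemma smult_add_left: "x \<in> carrier V \<Longrightarrow> (a + b) \<odot>\<^bsub>V\<^esub> x = a \<odot>\<^bsub>V\<^esub> x \<oplus>\<^bsub>V\<^esub> b \<odot>\<^bsub>V\<^esub> x"
  using smult_l_distr[of a b x] by simp

lemma smult_add_right:
  "\<lbrakk>x \<in> carrier V; y \<in> carrier V\<rbrakk> \<Longrightarrow> a \<odot>\<^bsub>V\<^esub> (x \<oplus>\<^bsub>V\<^esub> y) = a \<odot>\<^bsub>V\<^esub> x \<oplus>\<^bsub>V\<^esub> a \<odot>\<^bsub>V\<^esub> y"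
  using smult_r_distr[of a x y] by simp

lemma smult_smult: "x \<in> carrier V \<Longrightarrow> a \<odot>\<^bsub>V\<^esub> (b \<odot>\<^bsub>V\<^esub> x) = (a * b) \<odot>\<^bsub>V\<^esub> x"
  using smult_assoc1[of a b x] by simp

text \<open>Additive inverses reduce to scalar multiples, so linearity and norms extend to differences.\<close>
lemma minus_eq_smult: "x \<in> carrier V \<Longrightarrow> \<ominus>\<^bsub>V\<^esub> x = (- 1) \<odot>\<^bsub>V\<^esub> x"
  using smult_add_left[of x "- 1" 1] minus_equality[of "(- 1) \<odot>\<^bsub>V\<^esub> x" x] by simp

lemma diff_eq_smult: "x \<ominus>\<^bsub>V\<^esub> y = x \<oplus>\<^bsub>V\<^esub> (- 1) \<odot>\<^bsub>V\<^esub> y" if "y \<in> carrier V"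
  using that by (simp add: a_minus_def minus_eq_smult)

lemma vnorm_zero [simp]: "vnorm V \<zero>\<^bsub>V\<^esub> = 0"
  by (simp add: vnorm_eq_zero_iff)

lemma vnorm_minus [simp]: "x \<in> carrier V \<Longrightarrow> vnorm V (\<ominus>\<^bsub>V\<^esub> x) = vnorm V x"
  by (simp add: minus_eq_smult vnorm_smult)

lemma vnorm_nonneg: "0 \<le> vnorm V x" if "x \<in> carrier V"
  using vnorm_triangle[of x "\<ominus>\<^bsub>V\<^esub> x"] that by (simp add: r_neg)

lemma diff_swap: "\<lbrakk>x \<in> carrier V; y \<in> carrier V\<rbrakk> \<Longrightarrow> y \<ominus>\<^bsub>V\<^esub> x = \<ominus>\<^bsub>V\<^esub> (x \<ominus>\<^bsub>V\<^esub> y)"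
  by (simp add: a_minus_def minus_add a_comm)

lemma diff_chain:
  "\<lbrakk>x \<in> carrier V; y \<in> carrier V; z \<in> carrier V\<rbrakk> \<Longrightarrow>
    x \<ominus>\<^bsub>V\<^esub> z = (x \<ominus>\<^bsub>V\<^esub> y) \<oplus>\<^bsub>V\<^esub> (y \<ominus>\<^bsub>V\<^esub> z)"
  by (simp add: a_minus_def a_assoc r_neg2 r_neg1)

lemma diff_add_add:
  "\<lbrakk>x \<in> carrier V; y \<in> carrier V; u \<in> carrier V; v \<in> carrier V\<rbrakk> \<Longrightarrow>
    (x \<oplus>\<^bsub>V\<^esub> y) \<ominus>\<^bsub>V\<^esub> (u \<oplus>\<^bsub>V\<^esub> v) = (x \<ominus>\<^bsub>V\<^esub> u) \<oplus>\<^bsub>V\<^esub> (y \<ominus>\<^bsub>V\<^esub> v)"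
  by (simp add: a_minus_def minus_add a_ac)

lemma diff_eq_zero_iff:
  "\<lbrakk>x \<in> carrier V; y \<in> carrier V\<rbrakk> \<Longrightarrow> x \<ominus>\<^bsub>V\<^esub> y = \<zero>\<^bsub>V\<^esub> \<longleftrightarrow> x = y"
  using minus_equality[of x "\<ominus>\<^bsub>V\<^esub> y"] by (auto simp: a_minus_def r_neg)

lemma Metric_space_vdist: "Metric_space (carrier V) (vdist V)"
proof
  fix x y z
  show "0 \<le> vdist V x y"
    by (simp add: vdist_def vnorm_nonneg)
  show "vdist V x y = vdist V y x"
    by (auto simp: vdist_def diff_swap[of x y])
  assume x: "x \<in> carrier V" and y: "y \<in> carrier V"
  show "vdist V x y = 0 \<longleftrightarrow> x = y"
    using x y by (simp add: vdist_def vnorm_eq_zero_iff diff_eq_zero_iff)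
  assume z: "z \<in> carrier V"
  show "vdist V x z \<le> vdist V x y + vdist V y z"
    using x y z vnorm_triangle[of "x \<ominus>\<^bsub>V\<^esub> y" "y \<ominus>\<^bsub>V\<^esub> z"] by (simp add: vdist_def flip: diff_chain)
qed

lemma topspace_vtopology [simp]: "topspace (vtopology V) = carrier V"
  by (simp add: vtopology_def Metric_space.topspace_mtopology[OF Metric_space_vdist])

lemma openin_vball:
  assumes "x \<in> carrier V"
  shows "openin (vtopology V) {y \<in> carrier V. vnorm V (x \<ominus>\<^bsub>V\<^esub> y) < r}"
proof -
  interpret M: Metric_space "carrier V" "vdist V"
    by (rule Metric_space_vdist)
  have "{y \<in> carrier V. vnorm V (x \<ominus>\<^bsub>V\<^esub> y) < r} = M.mball x r"
    using assms by (auto simp: vdist_def)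
  then show ?thesis
    by (simp add: vtopology_def)
qed

lemma openin_vtopologyD:
  assumes "openin (vtopology V) U" "x \<in> U"
  obtains r where "0 < r" "\<And>y. \<lbrakk>y \<in> carrier V; vnorm V (x \<ominus>\<^bsub>V\<^esub> y) < r\<rbrakk> \<Longrightarrow> y \<in> U"
proof -
  interpret M: Metric_space "carrier V" "vdist V"
    by (rule Metric_space_vdist)
  obtain r where "0 < r" "M.mball x r \<subseteq> U"
    using assms unfolding vtopology_def M.openin_mtopology by blast
  moreover have "x \<in> carrier V"
    using assms openin_subset by fastforce
  ultimately show ?thesis
    using that by (auto simp: vdist_def subset_iff)
qed

text \<open>
  The domain is an arbitrary topological space because operators are continuous for a product
  topology, which is not given by a metric here.
\<close>
lemma continuous_map_vtopology_iff:
  "continuous_map Z (vtopology V) f \<longleftrightarrow>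
    f \<in> topspace Z \<rightarrow> carrier V \<and>
    (\<forall>x\<in>topspace Z. \<forall>e>0. \<exists>U. openin Z U \<and> x \<in> U \<and> (\<forall>y\<in>U. vnorm V (f x \<ominus>\<^bsub>V\<^esub> f y) < e))"
    (is "_ = ?rhs")
proof -
  interpret M: Metric_space "carrier V" "vdist V"
    by (rule Metric_space_vdist)
  have "continuous_map Z (vtopology V) f \<longleftrightarrow>
    (\<forall>x\<in>topspace Z. \<forall>e>0. \<exists>U. openin Z U \<and> x \<in> U \<and> (\<forall>y\<in>U. f y \<in> M.mball (f x) e))"
    by (simp add: vtopology_def M.continuous_map_to_metric)
  also have "\<dots> \<longleftrightarrow> ?rhs"
  proof safe
    fix x assume *: "\<forall>x\<in>topspace Z. \<forall>e>0. \<exists>U. openin Z U \<and> x \<in> U \<and> (\<forall>y\<in>U. f y \<in> M.mball (f x) e)"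
      and x: "x \<in> topspace Z"
    show "f x \<in> carrier V"
      using *[rule_format, OF x zero_less_one] by auto
    fix e :: real assume "0 < e"
    then obtain U where "openin Z U" "x \<in> U" "\<forall>y\<in>U. f y \<in> M.mball (f x) e"
      using *[rule_format, OF x] by auto
    then show "\<exists>U. openin Z U \<and> x \<in> U \<and> (\<forall>y\<in>U. vnorm V (f x \<ominus>\<^bsub>V\<^esub> f y) < e)"
      by (intro exI[of _ U]) (auto simp: vdist_def split: if_splits)
  next
    fix x and e :: real
    assume f: "f \<in> topspace Z \<rightarrow> carrier V" 
      and *: "\<forall>x\<in>topspace Z. \<forall>e>0. \<exists>U. openin Z U \<and> x \<in> U \<and> (\<forall>y\<in>U. vnorm V (f x \<ominus>\<^bsub>V\<^esub> f y) < e)"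
      and x: "x \<in> topspace Z" and e: "0 < e"
    from *[rule_format, OF x e] obtain U where U: "openin Z U" "x \<in> U" "\<And>y. y \<in> U \<Longrightarrow> vnorm V (f x \<ominus>\<^bsub>V\<^esub> f y) < e"
      by auto
    moreover have "f y \<in> carrier V" if "y \<in> U" for y
      using that f openin_subset[OF U(1)] by auto
    ultimately show "\<exists>U. openin Z U \<and> x \<in> U \<and> (\<forall>y\<in>U. f y \<in> M.mball (f x) e)"
      using x f by (intro exI[of _ U]) (auto simp: vdist_def)
  qed
  finally show ?thesis .
qed

text \<open>This is what makes the continuous operators into \<open>V\<close> closed under pointwise addition.\<close>
lemma continuous_map_vadd:
  assumes f: "continuous_map Z (vtopology V) f" and g: "continuous_map Z (vtopology V) g"
  shows "continuous_map Z (vtopology V) (\<lambda>x. f x \<oplus>\<^bsub>V\<^esub> g x)"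
  unfolding continuous_map_vtopology_iff
proof (intro conjI ballI allI impI)
  have fV: "f x \<in> carrier V" and gV: "g x \<in> carrier V" if "x \<in> topspace Z" for x
    using f g that by (auto simp: continuous_map_vtopology_iff)
  then show "(\<lambda>x. f x \<oplus>\<^bsub>V\<^esub> g x) \<in> topspace Z \<rightarrow> carrier V"
    by simp
  fix x and e :: real assume x: "x \<in> topspace Z" and "0 < e"
  then have e2: "0 < e / 2"
    by simp
  obtain U where U: "openin Z U" "x \<in> U" "\<And>y. y \<in> U \<Longrightarrow> vnorm V (f x \<ominus>\<^bsub>V\<^esub> f y) < e / 2"
    using f[unfolded continuous_map_vtopology_iff, THEN conjunct2, rule_format, OF x e2] by auto
  obtain W where W: "openin Z W" "x \<in> W" "\<And>y. y \<in> W \<Longrightarrow> vnorm V (g x \<ominus>\<^bsub>V\<^esub> g y) < e / 2"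
    using g[unfolded continuous_map_vtopology_iff, THEN conjunct2, rule_format, OF x e2] by auto
  have "vnorm V ((f x \<oplus>\<^bsub>V\<^esub> g x) \<ominus>\<^bsub>V\<^esub> (f y \<oplus>\<^bsub>V\<^esub> g y)) < e" if y: "y \<in> U \<inter> W" for y
  proof -
    have yX: "y \<in> topspace Z"
      using y openin_subset[OF U(1)] by auto
    have "vnorm V ((f x \<oplus>\<^bsub>V\<^esub> g x) \<ominus>\<^bsub>V\<^esub> (f y \<oplus>\<^bsub>V\<^esub> g y))
        \<le> vnorm V (f x \<ominus>\<^bsub>V\<^esub> f y) + vnorm V (g x \<ominus>\<^bsub>V\<^esub> g y)"
      using x yX by (simp add: diff_add_add vnorm_triangle fV gV)
    also have "\<dots> < e"
      using U(3)[of y] W(3)[of y] y by simp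
    finally show ?thesis .
  qed
  then show "\<exists>U. openin Z U \<and> x \<in> U \<and>
      (\<forall>y\<in>U. vnorm V ((f x \<oplus>\<^bsub>V\<^esub> g x) \<ominus>\<^bsub>V\<^esub> (f y \<oplus>\<^bsub>V\<^esub> g y)) < e)"
    using U W by (intro exI[of _ "U \<inter> W"]) (simp add: openin_Int)
qed

end

section \<open>Bounded linear maps and closed subspaces\<close>

text \<open>
  By linearity \<open>T x - T y = T (x - y)\<close>, so the bound on \<open>T\<close> is a Lipschitz estimate.
\<close>
lemma continuous_map_bounded_linear:
  assumes V: "normed_space V" and W: "normed_space W"
    and T: "T \<in> carrier V \<rightarrow> carrier W"
    and add: "\<And>x y. \<lbrakk>x \<in> carrier V; y \<in> carrier V\<rbrakk> \<Longrightarrow> T (x \<oplus>\<^bsub>V\<^esub> y) = T x \<oplus>\<^bsub>W\<^esub> T y"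
    and smult: "\<And>c x. x \<in> carrier V \<Longrightarrow> T (c \<odot>\<^bsub>V\<^esub> x) = c \<odot>\<^bsub>W\<^esub> T x"
    and bound: "\<And>x. x \<in> carrier V \<Longrightarrow> vnorm W (T x) \<le> C * vnorm V x"
  shows "continuous_map (vtopology V) (vtopology W) T"
proof -
  interpret V: normed_space V by (rule V)
  interpret W: normed_space W by (rule W)
  have TW: "T x \<in> carrier W" if "x \<in> carrier V" for x
    using T that by auto
  have diff: "T (x \<ominus>\<^bsub>V\<^esub> y) = T x \<ominus>\<^bsub>W\<^esub> T y" if "x \<in> carrier V" "y \<in> carrier V" for x y
    using that by (simp add: V.diff_eq_smult W.diff_eq_smult add smult TW)
  show ?thesis
    unfolding W.continuous_map_vtopology_iff
  proof (intro conjI ballI allI impI)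
    show "T \<in> topspace (vtopology V) \<rightarrow> carrier W"
      using T by simp
    fix x and e :: real assume "x \<in> topspace (vtopology V)" and e: "0 < e"
    then have x: "x \<in> carrier V"
      by simp
    \<comment> \<open>The bound \<open>C\<close> may be zero or negative; \<open>\<bar>C\<bar> + 1\<close> is a positive bound.\<close>
    define d where "d = e / (\<bar>C\<bar> + 1)"
    have d: "0 < d" "(\<bar>C\<bar> + 1) * d = e"
      using e by (simp_all add: d_def)
    let ?U = "{y \<in> carrier V. vnorm V (x \<ominus>\<^bsub>V\<^esub> y) < d}"
    have "vnorm W (T x \<ominus>\<^bsub>W\<^esub> T y) < e" if y: "y \<in> ?U" for y
    proof -
      have "vnorm W (T x \<ominus>\<^bsub>W\<^esub> T y) \<le> C * vnorm V (x \<ominus>\<^bsub>V\<^esub> y)"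
        using bound[of "x \<ominus>\<^bsub>V\<^esub> y"] x y by (simp add: diff)
      also have "\<dots> \<le> (\<bar>C\<bar> + 1) * vnorm V (x \<ominus>\<^bsub>V\<^esub> y)"
        using x y by (intro mult_right_mono V.vnorm_nonneg) auto
      also have "\<dots> < (\<bar>C\<bar> + 1) * d"
        using y by (intro mult_strict_left_mono) auto
      finally show ?thesis
        using d by simp
    qed
    moreover have "x \<in> ?U"
      using x d V.diff_eq_zero_iff[of x x] by simp
    ultimately show "\<exists>U. openin (vtopology V) U \<and> x \<in> U \<and> (\<forall>y\<in>U. vnorm W (T x \<ominus>\<^bsub>W\<^esub> T y) < e)"
      using V.openin_vball[OF x] by blast
  qed
qed

lemma (in normed_space) continuous_map_vsmult:
  assumes f: "continuous_map Z (vtopology V) f"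
  shows "continuous_map Z (vtopology V) (\<lambda>x. c \<odot>\<^bsub>V\<^esub> f x)"
proof -
  have "continuous_map (vtopology V) (vtopology V) (\<lambda>v. c \<odot>\<^bsub>V\<^esub> v)"
    by (rule continuous_map_bounded_linear[where C = "norm c"])
      (auto simp: normed_space_axioms smult_add_right smult_smult mult.commute vnorm_smult)
  then show ?thesis
    using continuous_map_compose[OF f] by (simp add: o_def)
qed

lemma closed_subspace_vimage:
  assumes V: "normed_space V" and W: "normed_space W"
    and T: "T \<in> carrier V \<rightarrow> carrier W"
    and add: "\<And>x y. \<lbrakk>x \<in> carrier V; y \<in> carrier V\<rbrakk> \<Longrightarrow> T (x \<oplus>\<^bsub>V\<^esub> y) = T x \<oplus>\<^bsub>W\<^esub> T y"
    and smult: "\<And>c x. x \<in> carrier V \<Longrightarrow> T (c \<odot>\<^bsub>V\<^esub> x) = c \<odot>\<^bsub>W\<^esub> T x"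
    and bound: "\<And>x. x \<in> carrier V \<Longrightarrow> vnorm W (T x) \<le> C * vnorm V x"
    and S: "closed_subspace W S"
  shows "closed_subspace V {x \<in> carrier V. T x \<in> S}"
proof -
  interpret V: normed_space V by (rule V)
  interpret W: normed_space W by (rule W)
  have sub: "submodule S scalars W"
    using S by (simp add: closed_subspace_def)
  note S_simps = W.submoduleE[OF sub]
  have smS: "c \<odot>\<^bsub>W\<^esub> x \<in> S" if "x \<in> S" for c x
    using S_simps(4)[of c x] that by simp
  have zero: "T \<zero>\<^bsub>V\<^esub> \<in> S"
  proof -
    obtain s where s: "s \<in> S"
      using S_simps(2) by blast
    have "T \<zero>\<^bsub>V\<^esub> \<in> carrier W"
      using T by auto
    then have "T \<zero>\<^bsub>V\<^esub> = \<zero>\<^bsub>W\<^esub>"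
      using smult[of "\<zero>\<^bsub>V\<^esub>" 0] by simp
    also have "\<dots> = 0 \<odot>\<^bsub>W\<^esub> s"
      using S_simps(1) s by auto
    finally show ?thesis
      using s by (simp add: smS)
  qed
  have "submodule {x \<in> carrier V. T x \<in> S} scalars V"
    by (rule V.submoduleI) (auto simp: zero V.minus_eq_smult smult add smS S_simps(5))
  moreover have "closedin (vtopology V) {x \<in> topspace (vtopology V). T x \<in> S}"
    using S by (intro closedin_continuous_map_preimage
        [OF continuous_map_bounded_linear[OF V W T add smult bound]])
      (auto simp: closed_subspace_def)
  ultimately show ?thesis
    by (simp add: closed_subspace_def)
qed

text \<open>
  The family has to be nonempty because the intersection of no sets is the whole type and not the
  carrier.
\<close>
lemma closed_subspace_Inter:
  assumes V: "normed_space V" and ne: "\<S> \<noteq> {}" and S: "\<And>S. S \<in> \<S> \<Longrightarrow> closed_subspace V S"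
  shows "closed_subspace V (\<Inter>\<S>)"
proof -
  interpret V: normed_space V by (rule V)
  have sub: "submodule S scalars V" if "S \<in> \<S>" for S
    using S[OF that] by (simp add: closed_subspace_def)
  note E = V.submoduleE[OF sub]
  have "submodule (\<Inter>\<S>) scalars V"
  proof (rule V.submoduleI)
    show "\<Inter>\<S> \<subseteq> carrier V"
      using ne E(1) by blast
    show "\<zero>\<^bsub>V\<^esub> \<in> \<Inter>\<S>"
    proof (rule InterI)
      fix S assume "S \<in> \<S>"
      then show "\<zero>\<^bsub>V\<^esub> \<in> S"
        using subgroup.one_closed[OF submodule.axioms(1)[OF sub]] by fastforce
    qed
  qed (blast intro: E(3-5))+
  moreover have "closedin (vtopology V) (\<Inter>\<S>)"
    using ne S by (intro closedin_Inter) (auto simp: closed_subspace_def)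
  ultimately show ?thesis
    by (simp add: closed_subspace_def)
qed

section \<open>The normed space of continuous multilinear operators\<close>

lemma multilinear_space_simps [simp]:
  "A \<in> carrier (multilinear_space I E F) \<longleftrightarrow> multilinear I E F A \<and>
     continuous_map (product_topology (\<lambda>i. vtopology (E i)) I) (vtopology F) A"
  "\<zero>\<^bsub>multilinear_space I E F\<^esub> = (\<lambda>x\<in>points I E. \<zero>\<^bsub>F\<^esub>)"
  "A \<oplus>\<^bsub>multilinear_space I E F\<^esub> B = (\<lambda>x\<in>points I E. A x \<oplus>\<^bsub>F\<^esub> B x)"
  "c \<odot>\<^bsub>multilinear_space I E F\<^esub> A = (\<lambda>x\<in>points I E. c \<odot>\<^bsub>F\<^esub> A x)"
  by (simp_all add: multilinear_space_def)

lemma vnorm_multilinear_space: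
  "vnorm (multilinear_space I E F) A =
    (SUP x\<in>{x \<in> points I E. \<forall>i\<in>I. vnorm (E i) (x i) \<le> 1}. vnorm F (A x))"
  by (simp add: multilinear_space_def)

lemma points_memD: "\<lbrakk>x \<in> points I E; i \<in> I\<rbrakk> \<Longrightarrow> x i \<in> carrier (E i)"
  by (auto simp: points_def)

lemma points_upd [simp]: "\<lbrakk>x \<in> points I E; i \<in> I; u \<in> carrier (E i)\<rbrakk> \<Longrightarrow> x(i := u) \<in> points I E"
  unfolding points_def by (auto simp: PiE_iff extensional_def)

lemma points_override_on:
  "\<lbrakk>x \<in> points (I - J) E; a \<in> points J E; J \<subseteq> I\<rbrakk> \<Longrightarrow> override_on x a J \<in> points I E"
  unfolding points_def by (auto simp: PiE_iff extensional_def override_on_def)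

lemma multilinearI:
  assumes "A \<in> extensional (points I E)" "\<And>x. x \<in> points I E \<Longrightarrow> A x \<in> carrier F"
    and "\<And>x i u v. \<lbrakk>x \<in> points I E; i \<in> I; u \<in> carrier (E i); v \<in> carrier (E i)\<rbrakk>
      \<Longrightarrow> A (x(i := u \<oplus>\<^bsub>E i\<^esub> v)) = A (x(i := u)) \<oplus>\<^bsub>F\<^esub> A (x(i := v))"
    and "\<And>x i c u. \<lbrakk>x \<in> points I E; i \<in> I; u \<in> carrier (E i)\<rbrakk>
      \<Longrightarrow> A (x(i := c \<odot>\<^bsub>E i\<^esub> u)) = c \<odot>\<^bsub>F\<^esub> A (x(i := u))"
  shows "multilinear I E F A"
  using assms unfolding multilinear_def by (simp add: PiE_iff)

lemma multilinearD:
  assumes "multilinear I E F A"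
  shows multilinear_extensional: "A \<in> extensional (points I E)"
    and multilinear_closed: "x \<in> points I E \<Longrightarrow> A x \<in> carrier F"
    and multilinear_add: "\<lbrakk>x \<in> points I E; i \<in> I; u \<in> carrier (E i); v \<in> carrier (E i)\<rbrakk>
      \<Longrightarrow> A (x(i := u \<oplus>\<^bsub>E i\<^esub> v)) = A (x(i := u)) \<oplus>\<^bsub>F\<^esub> A (x(i := v))"
    and multilinear_smult: "\<lbrakk>x \<in> points I E; i \<in> I; u \<in> carrier (E i)\<rbrakk>
      \<Longrightarrow> A (x(i := c \<odot>\<^bsub>E i\<^esub> u)) = c \<odot>\<^bsub>F\<^esub> A (x(i := u))"
  using assms unfolding multilinear_def PiE_iff by blast+

text \<open>
  With infinitely many coordinates a neighbourhood of zero in the product would leave some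
  coordinates unconstrained, and the products of norms below would lose their meaning; hence the
  finite index set. It is not an interval of numbers because the omission of coordinates leads from
  \<open>I\<close> to \<open>I - J\<close>.
\<close>
locale multilinear_setting = F: normed_space F
  for I :: "'i set" and E :: "'i \<Rightarrow> ('k::real_normed_field, 'a) normed_module"
    and F :: "('k, 'b) normed_module" +
  assumes finite_I: "finite I" and normed_E: "i \<in> I \<Longrightarrow> normed_space (E i)"
begin

abbreviation L where "L \<equiv> multilinear_space I E F"

abbreviation ptop where "ptop \<equiv> product_topology (\<lambda>i. vtopology (E i)) I"

lemma PiE_topspace_vtopology [simp]: "(\<Pi>\<^sub>E i\<in>I. topspace (vtopology (E i))) = points I E"
  unfolding points_def by (intro PiE_cong) (simp add: normed_space.topspace_vtopology normed_E)

lemma topspace_ptop: "topspace ptop = points I E"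
  by simp

lemma smult_E_closed: "\<lbrakk>i \<in> I; u \<in> carrier (E i)\<rbrakk> \<Longrightarrow> c \<odot>\<^bsub>E i\<^esub> u \<in> carrier (E i)"
  by (rule normed_space.smult_carrier[OF normed_E])

lemma add_E_closed: "\<lbrakk>i \<in> I; u \<in> carrier (E i); v \<in> carrier (E i)\<rbrakk> \<Longrightarrow> u \<oplus>\<^bsub>E i\<^esub> v \<in> carrier (E i)"
proof -
  assume i: "i \<in> I" and "u \<in> carrier (E i)" "v \<in> carrier (E i)"
  interpret normed_space "E i" by (rule normed_E[OF i])
  show ?thesis by (simp add: \<open>u \<in> carrier (E i)\<close> \<open>v \<in> carrier (E i)\<close>)
qed

lemma zero_point: "(\<lambda>i\<in>I. \<zero>\<^bsub>E i\<^esub>) \<in> points I E"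
proof -
  have "\<zero>\<^bsub>E i\<^esub> \<in> carrier (E i)" if "i \<in> I" for i
  proof -
    interpret normed_space "E i" by (rule normed_E[OF that])
    show ?thesis by simp
  qed
  then show ?thesis
    by (simp add: points_def)
qed

lemma vnorm_point_nonneg: "\<lbrakk>x \<in> points I E; i \<in> I\<rbrakk> \<Longrightarrow> 0 \<le> vnorm (E i) (x i)"
  by (simp add: normed_space.vnorm_nonneg normed_E points_memD)

text \<open>A coordinate that is zero can be written as \<open>0\<close> times itself, and the scalar moves out.\<close>
lemma multilinear_zero_coordinate:
  assumes A: "multilinear I E F A" and x: "x \<in> points I E" and i: "i \<in> I" "vnorm (E i) (x i) = 0"
  shows "A x = \<zero>\<^bsub>F\<^esub>"
proof -
  interpret Ei: normed_space "E i" by (rule normed_E[OF i(1)])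
  have xi: "x i \<in> carrier (E i)"
    by (rule points_memD[OF x i(1)])
  then have "x = x(i := 0 \<odot>\<^bsub>E i\<^esub> x i)"
    using i Ei.vnorm_eq_zero_iff by (auto simp: fun_eq_iff)
  then have "A x = 0 \<odot>\<^bsub>F\<^esub> A (x(i := x i))"
    using multilinear_smult[OF A x i(1) xi] by metis
  then show ?thesis
    using multilinear_closed[OF A x] by simp
qed

text \<open>
  Only the coordinates in \<open>K\<close> are scaled, so that the statement can be proved by induction on \<open>K\<close>,
  one coordinate at a time; it is used for \<open>K = I\<close>.
\<close>
lemma multilinear_scale:
  assumes A: "multilinear I E F A" and x: "x \<in> points I E" and K: "K \<subseteq> I"
  shows "A (\<lambda>i\<in>I. if i \<in> K then c i \<odot>\<^bsub>E i\<^esub> x i else x i) = (\<Prod>i\<in>K. c i) \<odot>\<^bsub>F\<^esub> A x"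
  using finite_subset[OF K finite_I] K
proof (induction K rule: finite_induct)
  case empty
  have "(\<lambda>i\<in>I. x i) = x"
    using x by (simp add: points_def PiE_iff extensional_restrict)
  then show ?case
    using multilinear_closed[OF A x] by simp
next
  case (insert j K)
  define y where "y = (\<lambda>i\<in>I. if i \<in> K then c i \<odot>\<^bsub>E i\<^esub> x i else x i)"
  have j: "j \<in> I"
    using insert by simp
  have y: "y \<in> points I E"
    using x by (auto simp: y_def points_def PiE_iff smult_E_closed)
  have "(\<lambda>i\<in>I. if i \<in> insert j K then c i \<odot>\<^bsub>E i\<^esub> x i else x i) = y(j := c j \<odot>\<^bsub>E j\<^esub> x j)"
    using j by (auto simp: y_def fun_eq_iff)
  then have "A (\<lambda>i\<in>I. if i \<in> insert j K then c i \<odot>\<^bsub>E i\<^esub> x i else x i)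
      = A (y(j := c j \<odot>\<^bsub>E j\<^esub> x j))"
    by (rule arg_cong)
  also have "\<dots> = c j \<odot>\<^bsub>F\<^esub> A (y(j := x j))"
    by (rule multilinear_smult[OF A y j points_memD[OF x j]])
  also have "y(j := x j) = y"
    using j insert by (auto simp: y_def fun_eq_iff)
  also have "A y = (\<Prod>i\<in>K. c i) \<odot>\<^bsub>F\<^esub> A x"
    using insert.IH insert.prems unfolding y_def by blast
  also have "c j \<odot>\<^bsub>F\<^esub> \<dots> = (\<Prod>i\<in>insert j K. c i) \<odot>\<^bsub>F\<^esub> A x"
    using insert multilinear_closed[OF A x] by (simp add: F.smult_smult)
  finally show ?case .
qed

text \<open>
  If no coordinate of \<open>x\<close> vanishes, scaling the \<open>i\<close>-th one by \<open>r / \<parallel>x i\<parallel>\<close> gives a point at which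
  the bound \<open>C\<close> applies, and homogeneity translates it back; if one vanishes, both sides are zero.
  The radius \<open>r\<close> is arbitrary because the result is needed twice: for a small ball provided by
  continuity, and for the unit ball.
\<close>
lemma multilinear_bound_scale:
  assumes A: "multilinear I E F A" and r: "0 < r"
    and C: "\<And>y. \<lbrakk>y \<in> points I E; \<forall>i\<in>I. vnorm (E i) (y i) \<le> r\<rbrakk> \<Longrightarrow> vnorm F (A y) \<le> C"
    and x: "x \<in> points I E"
  shows "vnorm F (A x) \<le> C * (\<Prod>i\<in>I. vnorm (E i) (x i) / r)"
proof (cases "\<exists>i\<in>I. vnorm (E i) (x i) = 0")
  case True
  then have "A x = \<zero>\<^bsub>F\<^esub>"
    using multilinear_zero_coordinate[OF A x] by blast
  moreover have "(\<Prod>i\<in>I. vnorm (E i) (x i) / r) = 0"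
    using True finite_I by (auto simp: prod_zero_iff)
  ultimately show ?thesis
    by simp
next
  case False
  then have pos: "0 < vnorm (E i) (x i)" if "i \<in> I" for i
    using vnorm_point_nonneg[OF x that] that by (auto simp: less_le)
  define c where "c i = (of_real (r / vnorm (E i) (x i)) :: 'k)" for i
  define y where "y = (\<lambda>i\<in>I. c i \<odot>\<^bsub>E i\<^esub> x i)"
  have y: "y \<in> points I E"
    using x by (auto simp: y_def points_def PiE_iff smult_E_closed)
  have nc: "norm (c i) = r / vnorm (E i) (x i)" if "i \<in> I" for i
    using pos[OF that] r by (simp add: c_def norm_divide)
  have "vnorm (E i) (y i) = r" if "i \<in> I" for i
    using normed_space.vnorm_smult[OF normed_E[OF that] points_memD[OF x that]] pos[OF that] nc that
    by (simp add: y_def)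
  then have "vnorm F (A y) \<le> C"
    using C[OF y] by simp
  moreover have "A y = (\<Prod>i\<in>I. c i) \<odot>\<^bsub>F\<^esub> A x"
    using multilinear_scale[OF A x subset_refl, of c] by (simp add: y_def cong: restrict_cong)
  ultimately have *: "(\<Prod>i\<in>I. r / vnorm (E i) (x i)) * vnorm F (A x) \<le> C"
    by (simp add: F.vnorm_smult multilinear_closed[OF A x] nc flip: prod_norm cong: prod.cong)
  have inv: "(\<Prod>i\<in>I. vnorm (E i) (x i) / r) * (\<Prod>i\<in>I. r / vnorm (E i) (x i)) = 1"
    unfolding prod.distrib[symmetric] using r False by (intro prod.neutral) auto
  have "0 \<le> (\<Prod>i\<in>I. vnorm (E i) (x i) / r)"
    using r vnorm_point_nonneg[OF x] by (intro prod_nonneg) simp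
  from mult_left_mono[OF * this] show ?thesis
    using inv by (simp add: mult.assoc[symmetric] mult.commute[of C])
qed

text \<open>
  Continuity at the origin bounds \<open>A\<close> on a neighbourhood of it. In a finite product this
  neighbourhood contains a product of balls of a common radius, and by the previous lemma the bound
  passes from there to the unit ball.
\<close>
lemma multilinear_space_bounded:
  assumes A: "A \<in> carrier L"
  obtains C where "\<And>y. \<lbrakk>y \<in> points I E; \<forall>i\<in>I. vnorm (E i) (y i) \<le> 1\<rbrakk> \<Longrightarrow> vnorm F (A y) \<le> C"
proof -
  let ?z = "\<lambda>i\<in>I. \<zero>\<^bsub>E i\<^esub>"
  have ml: "multilinear I E F A" and cont: "continuous_map ptop (vtopology F) A"
    using A by simp_all
  obtain U where U: "openin ptop U" "?z \<in> U" "\<And>y. y \<in> U \<Longrightarrow> vnorm F (A ?z \<ominus>\<^bsub>F\<^esub> A y) < 1"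
    using cont zero_point zero_less_one unfolding F.continuous_map_vtopology_iff topspace_ptop by blast
  obtain W where W: "\<And>i. i \<in> I \<Longrightarrow> openin (vtopology (E i)) (W i)" "?z \<in> Pi\<^sub>E I W" "Pi\<^sub>E I W \<subseteq> U"
    using U(1,2) unfolding openin_product_topology_alt by meson
  have "\<exists>s>0. \<forall>u\<in>carrier (E i). vnorm (E i) u < s \<longrightarrow> u \<in> W i" if i: "i \<in> I" for i
  proof -
    interpret Ei: normed_space "E i" by (rule normed_E[OF i])
    have "\<zero>\<^bsub>E i\<^esub> \<in> W i"
      using W(2) i by (auto simp: PiE_iff)
    then obtain s where s: "0 < s" "\<And>u. \<lbrakk>u \<in> carrier (E i); vnorm (E i) (\<zero>\<^bsub>E i\<^esub> \<ominus>\<^bsub>E i\<^esub> u) < s\<rbrakk> \<Longrightarrow> u \<in> W i"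
      using Ei.openin_vtopologyD[OF W(1)[OF i]] by blast
    then show ?thesis
      by (intro exI[of _ s]) (simp add: a_minus_def)
  qed
  then obtain s where s: "\<And>i. i \<in> I \<Longrightarrow> 0 < s i"
    "\<And>i u. \<lbrakk>i \<in> I; u \<in> carrier (E i); vnorm (E i) u < s i\<rbrakk> \<Longrightarrow> u \<in> W i"
    by metis
  \<comment> \<open>Inserting 1 keeps the minimum defined for an empty \<open>I\<close>; halving makes \<open>r\<close> strictly smaller than
    each \<open>s i\<close>, as balls are open.\<close>
  define r where "r = Min (insert 1 (s ` I)) / 2"
  have "0 < Min (insert 1 (s ` I))"
    using finite_I s(1) by (subst Min_gr_iff) auto
  moreover have "Min (insert 1 (s ` I)) \<le> s i" if "i \<in> I" for i
    using finite_I that by (intro Min_le) auto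
  ultimately have r: "0 < r" "\<And>i. i \<in> I \<Longrightarrow> r < s i"
    by (auto simp: r_def) (smt (verit) field_sum_of_halves)
  have Az: "A ?z \<in> carrier F"
    by (rule multilinear_closed[OF ml zero_point])
  have "vnorm F (A y) \<le> vnorm F (A ?z) + 1"
    if y: "y \<in> points I E" and small: "\<forall>i\<in>I. vnorm (E i) (y i) \<le> r" for y
  proof -
    have "y i \<in> W i" if i: "i \<in> I" for i
      using small[rule_format, OF i] r(2)[OF i] by (intro s(2)[OF i points_memD[OF y i]]) simp
    then have "y \<in> Pi\<^sub>E I W"
      using y by (simp add: points_def PiE_iff)
    then have less: "vnorm F (A ?z \<ominus>\<^bsub>F\<^esub> A y) < 1"
      using U(3)[of y] W(3) by blast
    have Ay: "A y \<in> carrier F"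
      by (rule multilinear_closed[OF ml y])
    have "A y = A ?z \<oplus>\<^bsub>F\<^esub> (A y \<ominus>\<^bsub>F\<^esub> A ?z)"
      using F.a_lcomm[of "A ?z" "A y" "\<ominus>\<^bsub>F\<^esub> A ?z"] Ay Az by (simp add: a_minus_def F.r_neg)
    then have "vnorm F (A y) \<le> vnorm F (A ?z) + vnorm F (A y \<ominus>\<^bsub>F\<^esub> A ?z)"
      using F.vnorm_triangle[of "A ?z" "A y \<ominus>\<^bsub>F\<^esub> A ?z"] Ay Az by simp
    also have "vnorm F (A y \<ominus>\<^bsub>F\<^esub> A ?z) = vnorm F (A ?z \<ominus>\<^bsub>F\<^esub> A y)"
      using Ay Az F.diff_swap[of "A ?z" "A y"] by simp
    finally show ?thesis
      using less by linarith
  qed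
  note bound = multilinear_bound_scale[OF ml r(1) this]
  let ?C = "(vnorm F (A ?z) + 1) * (\<Prod>i\<in>I. 1 / r)"
  have "vnorm F (A y) \<le> ?C" if y: "y \<in> points I E" "\<forall>i\<in>I. vnorm (E i) (y i) \<le> 1" for y
  proof -
    have "vnorm F (A y) \<le> (vnorm F (A ?z) + 1) * (\<Prod>i\<in>I. vnorm (E i) (y i) / r)"
      by (rule bound[OF _ _ y(1)])
    also have "\<dots> \<le> ?C"
      using y r(1) F.vnorm_nonneg[OF Az] vnorm_point_nonneg[OF y(1)]
      by (intro mult_left_mono prod_mono) (auto simp: divide_right_mono)
    finally show ?thesis .
  qed
  then show ?thesis
    by (rule that)
qed

text \<open>
  A real supremum over an unbounded set is an unspecified number; by the boundedness of \<open>A\<close> the sup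
  norm is an actual supremum.
\<close>
lemma vnorm_upper:
  assumes A: "A \<in> carrier L" and y: "y \<in> points I E" "\<forall>i\<in>I. vnorm (E i) (y i) \<le> 1"
  shows "vnorm F (A y) \<le> vnorm L A"
proof -
  obtain C where "\<And>y. \<lbrakk>y \<in> points I E; \<forall>i\<in>I. vnorm (E i) (y i) \<le> 1\<rbrakk> \<Longrightarrow> vnorm F (A y) \<le> C"
    using multilinear_space_bounded[OF A] by blast
  then show ?thesis
    unfolding vnorm_multilinear_space using y by (intro cSUP_upper bdd_aboveI2[where M = C]) auto
qed

lemma vnorm_least:
  assumes "\<And>y. \<lbrakk>y \<in> points I E; \<forall>i\<in>I. vnorm (E i) (y i) \<le> 1\<rbrakk> \<Longrightarrow> vnorm F (A y) \<le> C"
  shows "vnorm L A \<le> C"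
  unfolding vnorm_multilinear_space
proof (rule cSUP_least)
  have "(\<lambda>i\<in>I. \<zero>\<^bsub>E i\<^esub>) \<in> {x \<in> points I E. \<forall>i\<in>I. vnorm (E i) (x i) \<le> 1}"
    by (simp add: zero_point normed_space.vnorm_zero[OF normed_E])
  then show "{x \<in> points I E. \<forall>i\<in>I. vnorm (E i) (x i) \<le> 1} \<noteq> {}"
    by blast
qed (use assms in auto)

lemma vnorm_eval:
  assumes A: "A \<in> carrier L" and x: "x \<in> points I E"
  shows "vnorm F (A x) \<le> vnorm L A * (\<Prod>i\<in>I. vnorm (E i) (x i))"
  using multilinear_bound_scale[of A 1 "vnorm L A" x] vnorm_upper[OF A] A x by simp

lemma vnorm_multilinear_nonneg:
  assumes A: "A \<in> carrier L"
  shows "0 \<le> vnorm L A"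
proof -
  have "0 \<le> vnorm F (A (\<lambda>i\<in>I. \<zero>\<^bsub>E i\<^esub>))"
    using A by (intro F.vnorm_nonneg multilinear_closed[OF _ zero_point]) simp
  also have "\<dots> \<le> vnorm L A"
    by (rule vnorm_upper[OF A zero_point]) (simp add: normed_space.vnorm_zero[OF normed_E])
  finally show ?thesis .
qed

lemma zero_in_space: "\<zero>\<^bsub>L\<^esub> \<in> carrier L"
proof -
  have "continuous_map ptop (vtopology F) (\<lambda>x\<in>points I E. \<zero>\<^bsub>F\<^esub>)"
    by (rule continuous_map_eq[of _ _ "\<lambda>x. \<zero>\<^bsub>F\<^esub>"]) auto
  moreover have "multilinear I E F (\<lambda>x\<in>points I E. \<zero>\<^bsub>F\<^esub>)"
    by (rule multilinearI) (simp_all add: smult_E_closed add_E_closed)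
  ultimately show ?thesis
    by simp
qed

lemma add_in_space:
  assumes A: "A \<in> carrier L" and B: "B \<in> carrier L"
  shows "A \<oplus>\<^bsub>L\<^esub> B \<in> carrier L"
proof -
  have mA: "multilinear I E F A" and mB: "multilinear I E F B"
    using A B by simp_all
  note cl = multilinear_closed[OF mA] multilinear_closed[OF mB]
  have "continuous_map ptop (vtopology F) (\<lambda>x\<in>points I E. A x \<oplus>\<^bsub>F\<^esub> B x)"
    by (rule continuous_map_eq[OF F.continuous_map_vadd[of _ A B]]) (use A B in simp_all)
  moreover have "multilinear I E F (\<lambda>x\<in>points I E. A x \<oplus>\<^bsub>F\<^esub> B x)"
    by (rule multilinearI) (simp_all add: smult_E_closed add_E_closed cl multilinear_add[OF mA]
        multilinear_add[OF mB] multilinear_smult[OF mA] multilinear_smult[OF mB] F.a_ac F.smult_add_right)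
  ultimately show ?thesis
    by simp
qed

lemma smult_in_space:
  assumes A: "A \<in> carrier L"
  shows "c \<odot>\<^bsub>L\<^esub> A \<in> carrier L"
proof -
  have mA: "multilinear I E F A"
    using A by simp
  note cl = multilinear_closed[OF mA]
  have "continuous_map ptop (vtopology F) (\<lambda>x\<in>points I E. c \<odot>\<^bsub>F\<^esub> A x)"
    by (rule continuous_map_eq[OF F.continuous_map_vsmult[of _ A c]]) (use A in simp_all)
  moreover have "multilinear I E F (\<lambda>x\<in>points I E. c \<odot>\<^bsub>F\<^esub> A x)"
    by (rule multilinearI) (simp_all add: smult_E_closed add_E_closed cl multilinear_add[OF mA]
        multilinear_smult[OF mA] F.smult_add_right F.smult_smult mult.commute)
  ultimately show ?thesis
    by simp
qed

lemma space_closed: "\<lbrakk>A \<in> carrier L; x \<in> points I E\<rbrakk> \<Longrightarrow> A x \<in> carrier F"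
  using multilinear_closed[of I E F A x] by simp

text \<open>
  Operators are extensional functions, so identities between them, in particular the module laws,
  can be checked pointwise in \<open>F\<close>.
\<close>
lemma space_eqI:
  assumes "A \<in> carrier L" "B \<in> carrier L" "\<And>x. x \<in> points I E \<Longrightarrow> A x = B x"
  shows "A = B"
  using assms multilinear_extensional[of I E F A] multilinear_extensional[of I E F B]
  by (intro extensionalityI[of A "points I E" B]) simp_all

lemma abelian_group_space: "abelian_group L"
proof (rule abelian_groupI)
  fix A B C assume A: "A \<in> carrier L" and B: "B \<in> carrier L" and C: "C \<in> carrier L"
  show "A \<oplus>\<^bsub>L\<^esub> B \<in> carrier L"
    by (rule add_in_space[OF A B])
  show "A \<oplus>\<^bsub>L\<^esub> B \<oplus>\<^bsub>L\<^esub> C = A \<oplus>\<^bsub>L\<^esub> (B \<oplus>\<^bsub>L\<^esub> C)"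
    by (rule space_eqI[OF add_in_space[OF add_in_space[OF A B] C] add_in_space[OF A add_in_space[OF B C]]])
      (use A B C in \<open>simp add: space_closed F.a_assoc\<close>)
  show "A \<oplus>\<^bsub>L\<^esub> B = B \<oplus>\<^bsub>L\<^esub> A"
    by (rule space_eqI[OF add_in_space[OF A B] add_in_space[OF B A]])
      (use A B in \<open>simp add: space_closed F.a_comm\<close>)
  show "\<zero>\<^bsub>L\<^esub> \<oplus>\<^bsub>L\<^esub> A = A"
    by (rule space_eqI[OF add_in_space[OF zero_in_space A] A])
      (use A in \<open>simp add: space_closed\<close>)
  have "(- 1) \<odot>\<^bsub>L\<^esub> A \<oplus>\<^bsub>L\<^esub> A = \<zero>\<^bsub>L\<^esub>"
    by (rule space_eqI[OF add_in_space[OF smult_in_space[OF A] A] zero_in_space])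
      (use A in \<open>simp add: space_closed F.l_neg flip: F.minus_eq_smult\<close>)
  then show "\<exists>B\<in>carrier L. B \<oplus>\<^bsub>L\<^esub> A = \<zero>\<^bsub>L\<^esub>"
    using smult_in_space[OF A] by blast
qed (rule zero_in_space)

lemma module_space: "module scalars L"
proof (rule moduleI)
  show "cring (scalars :: 'k ring)"
    by (rule F.is_cring)
  show "abelian_group L"
    by (rule abelian_group_space)
  fix a b :: 'k and A B assume A: "A \<in> carrier L"
  show "a \<odot>\<^bsub>L\<^esub> A \<in> carrier L"
    by (rule smult_in_space[OF A])
  show "(a \<oplus>\<^bsub>scalars\<^esub> b) \<odot>\<^bsub>L\<^esub> A = a \<odot>\<^bsub>L\<^esub> A \<oplus>\<^bsub>L\<^esub> b \<odot>\<^bsub>L\<^esub> A"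
    by (rule space_eqI[OF smult_in_space[OF A] add_in_space[OF smult_in_space[OF A] smult_in_space[OF A]]])
      (use A in \<open>simp add: space_closed F.smult_add_left\<close>)
  show "(a \<otimes>\<^bsub>scalars\<^esub> b) \<odot>\<^bsub>L\<^esub> A = a \<odot>\<^bsub>L\<^esub> (b \<odot>\<^bsub>L\<^esub> A)"
    by (rule space_eqI[OF smult_in_space[OF A] smult_in_space[OF smult_in_space[OF A]]])
      (use A in \<open>simp add: space_closed F.smult_smult\<close>)
  show "\<one>\<^bsub>scalars\<^esub> \<odot>\<^bsub>L\<^esub> A = A"
    by (rule space_eqI[OF smult_in_space[OF A] A])
      (use A in \<open>simp add: space_closed\<close>)
  assume B: "B \<in> carrier L"
  show "a \<odot>\<^bsub>L\<^esub> (A \<oplus>\<^bsub>L\<^esub> B) = a \<odot>\<^bsub>L\<^esub> A \<oplus>\<^bsub>L\<^esub> a \<odot>\<^bsub>L\<^esub> B"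
    by (rule space_eqI[OF smult_in_space[OF add_in_space[OF A B]]
          add_in_space[OF smult_in_space[OF A] smult_in_space[OF B]]])
      (use A B in \<open>simp add: space_closed F.smult_add_right\<close>)
qed

lemma vnorm_smult_le:
  assumes A: "A \<in> carrier L"
  shows "vnorm L (c \<odot>\<^bsub>L\<^esub> A) \<le> norm c * vnorm L A"
proof (rule vnorm_least)
  fix y assume y: "y \<in> points I E" "\<forall>i\<in>I. vnorm (E i) (y i) \<le> 1"
  have "vnorm F ((c \<odot>\<^bsub>L\<^esub> A) y) = norm c * vnorm F (A y)"
    using y space_closed[OF A] by (simp add: F.vnorm_smult)
  also have "\<dots> \<le> norm c * vnorm L A"
    using vnorm_upper[OF A y] by (simp add: mult_left_mono)
  finally show "vnorm F ((c \<odot>\<^bsub>L\<^esub> A) y) \<le> norm c * vnorm L A" .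
qed

text \<open>
  Definiteness comes from \<open>vnorm_eval\<close>: an operator of norm zero vanishes at every point. For
  homogeneity, the missing inequality is the one already known, applied to \<open>c\<^sup>-\<^sup>1\<close> and \<open>c A\<close>.
\<close>
lemma normed_space_multilinear: "normed_space L"
proof -
  interpret L: module scalars L
    by (rule module_space)
  show ?thesis
  proof
    fix A assume A: "A \<in> carrier L"
    show "vnorm L A = 0 \<longleftrightarrow> A = \<zero>\<^bsub>L\<^esub>"
    proof
      assume 0: "vnorm L A = 0"
      have "A x = \<zero>\<^bsub>L\<^esub> x" if x: "x \<in> points I E" for x
      proof -
        have "vnorm F (A x) = 0"
          using vnorm_eval[OF A x] 0 F.vnorm_nonneg[OF space_closed[OF A x]] by simp
        then show ?thesis
          using x by (simp add: F.vnorm_eq_zero_iff[OF space_closed[OF A x]])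
      qed
      then show "A = \<zero>\<^bsub>L\<^esub>"
        by (rule space_eqI[OF A zero_in_space])
    next
      assume "A = \<zero>\<^bsub>L\<^esub>"
      then have "vnorm L A \<le> 0"
        by (intro vnorm_least) simp
      then show "vnorm L A = 0"
        using vnorm_multilinear_nonneg[OF A] by simp
    qed
    show "vnorm L (c \<odot>\<^bsub>L\<^esub> A) = norm c * vnorm L A" for c
    proof (rule antisym)
      show "norm c * vnorm L A \<le> vnorm L (c \<odot>\<^bsub>L\<^esub> A)"
      proof (cases "c = 0")
        case True
        then show ?thesis
          using vnorm_multilinear_nonneg[OF smult_in_space[OF A]] by simp
      next
        case False
        have "(inverse c * c) \<odot>\<^bsub>L\<^esub> A = inverse c \<odot>\<^bsub>L\<^esub> (c \<odot>\<^bsub>L\<^esub> A)"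
          using L.smult_assoc1[of "inverse c" c A] A by simp
        then have "A = inverse c \<odot>\<^bsub>L\<^esub> (c \<odot>\<^bsub>L\<^esub> A)"
          using False L.smult_one[OF A] by simp
        then have "vnorm L A \<le> norm (inverse c) * vnorm L (c \<odot>\<^bsub>L\<^esub> A)"
          using vnorm_smult_le[OF smult_in_space[OF A]] by metis
        from mult_left_mono[OF this norm_ge_zero[of c]]
        have "norm c * vnorm L A
            \<le> (norm c * norm (inverse c)) * vnorm L (c \<odot>\<^bsub>L\<^esub> A)"
          by (simp only: mult.assoc)
        also have "norm c * norm (inverse c) = 1"
          using False by (simp flip: norm_mult)
        finally show ?thesis
          by (simp only: mult_1)
      qed
    qed (rule vnorm_smult_le[OF A])
    fix B assume B: "B \<in> carrier L"
    show "vnorm L (A \<oplus>\<^bsub>L\<^esub> B) \<le> vnorm L A + vnorm L B"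
    proof (rule vnorm_least)
      fix y assume y: "y \<in> points I E" "\<forall>i\<in>I. vnorm (E i) (y i) \<le> 1"
      have "vnorm F ((A \<oplus>\<^bsub>L\<^esub> B) y) \<le> vnorm F (A y) + vnorm F (B y)"
        using y space_closed[OF A] space_closed[OF B] by (simp add: F.vnorm_triangle)
      also have "\<dots> \<le> vnorm L A + vnorm L B"
        by (intro add_mono vnorm_upper A B y)
      finally show "vnorm F ((A \<oplus>\<^bsub>L\<^esub> B) y) \<le> vnorm L A + vnorm L B" .
    qed
  qed
qed

section \<open>Fixing variables is a bounded linear map\<close>

lemma multilinear_setting_subset:
  assumes "K \<subseteq> I"
  shows "multilinear_setting K E F"
proof (intro multilinear_setting.intro multilinear_setting_axioms.intro)
  show "normed_space F"
    by (rule F.normed_space_axioms)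
  show "finite K"
    using assms finite_I by (rule finite_subset)
  show "normed_space (E i)" if "i \<in> K" for i
    using assms that by (intro normed_E) blast
qed

text \<open>
  The resulting operator is \<open>A\<close> after the map that fills in the values \<open>a\<close>. This map is continuous,
  as each of its coordinates is a projection or a constant, and it commutes with changing one of the
  remaining coordinates.
\<close>
lemma resulting_in_space:
  assumes J: "J \<subseteq> I" and a: "a \<in> points J E" and A: "A \<in> carrier L"
  shows "resulting I E A J a \<in> carrier (multilinear_space (I - J) E F)"
proof -
  interpret R: multilinear_setting "I - J" E F
    by (rule multilinear_setting_subset) simp
  have mA: "multilinear I E F A"
    using A by simp
  note over = points_override_on[OF _ a J]
  have upd: "override_on (x(i := u)) a J = (override_on x a J)(i := u)" if "i \<notin> J" for x i u
    using that by (auto simp: override_on_def fun_eq_iff)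
  have coord: "continuous_map R.ptop (vtopology (E i)) (\<lambda>x. override_on x a J i)" if i: "i \<in> I" for i
  proof (cases "i \<in> J")
    case True
    then have "a i \<in> topspace (vtopology (E i))"
      using points_memD[OF a] by (simp add: normed_space.topspace_vtopology[OF normed_E[OF i]])
    then show ?thesis
      using True by (simp add: override_on_def)
  next
    case False
    then show ?thesis
      using i continuous_map_product_projection[of i "I - J" "\<lambda>i. vtopology (E i)"]
      by (simp add: override_on_def)
  qed
  have over_cont: "continuous_map R.ptop ptop (\<lambda>x. override_on x a J)"
    unfolding continuous_map_componentwise using coord over by (auto simp: points_def PiE_iff)
  have "continuous_map R.ptop (vtopology F) (\<lambda>x. A (override_on x a J))"
    using continuous_map_compose[OF over_cont, of "vtopology F" A] A by (simp add: o_def)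
  then have "continuous_map R.ptop (vtopology F) (resulting I E A J a)"
    by (rule continuous_map_eq) (simp add: resulting_def)
  moreover have "multilinear (I - J) E F (resulting I E A J a)"
    unfolding resulting_def
    by (rule multilinearI) (simp_all add: R.smult_E_closed R.add_E_closed over upd
        multilinear_closed[OF mA] multilinear_add[OF mA] multilinear_smult[OF mA])
  ultimately show ?thesis
    by simp
qed

text \<open>
  Evaluate \<open>A\<close> at a point of the unit ball completed by \<open>a\<close>: in the product of the norms of the
  coordinates, those outside \<open>J\<close> contribute at most 1.
\<close>
lemma vnorm_resulting_le:
  assumes J: "J \<subseteq> I" and a: "a \<in> points J E" and A: "A \<in> carrier L"
  shows "vnorm (multilinear_space (I - J) E F) (resulting I E A J a)
    \<le> (\<Prod>j\<in>J. vnorm (E j) (a j)) * vnorm L A"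
proof -
  interpret R: multilinear_setting "I - J" E F
    by (rule multilinear_setting_subset) simp
  interpret S: multilinear_setting J E F
    by (rule multilinear_setting_subset[OF J])
  show ?thesis
  proof (rule R.vnorm_least)
    fix y assume y: "y \<in> points (I - J) E" "\<forall>i\<in>I - J. vnorm (E i) (y i) \<le> 1"
    let ?z = "override_on y a J"
    have "(\<Prod>i\<in>I. vnorm (E i) (?z i))
        = (\<Prod>i\<in>I - J. vnorm (E i) (y i)) * (\<Prod>j\<in>J. vnorm (E j) (a j))"
      by (simp add: prod.subset_diff[OF J finite_I])
    also have "\<dots> \<le> 1 * (\<Prod>j\<in>J. vnorm (E j) (a j))"
      using y R.vnorm_point_nonneg[OF y(1)] S.vnorm_point_nonneg[OF a]
      by (intro mult_right_mono prod_le_1 prod_nonneg) auto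
    finally have le: "(\<Prod>i\<in>I. vnorm (E i) (?z i)) \<le> (\<Prod>j\<in>J. vnorm (E j) (a j))"
      by simp
    have "vnorm F (resulting I E A J a y) = vnorm F (A ?z)"
      using y by (simp add: resulting_def)
    also have "\<dots> \<le> vnorm L A * (\<Prod>i\<in>I. vnorm (E i) (?z i))"
      by (rule vnorm_eval[OF A points_override_on[OF y(1) a J]])
    also have "\<dots> \<le> vnorm L A * (\<Prod>j\<in>J. vnorm (E j) (a j))"
      by (rule mult_left_mono[OF le vnorm_multilinear_nonneg[OF A]])
    finally show "vnorm F (resulting I E A J a y) \<le> (\<Prod>j\<in>J. vnorm (E j) (a j)) * vnorm L A"
      by (simp only: mult.commute)
  qed
qed

lemma closed_subspace_resulting:
  assumes J: "J \<subseteq> I" and a: "a \<in> points J E"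
    and S: "closed_subspace (multilinear_space (I - J) E F) S"
  shows "closed_subspace L {A \<in> carrier L. resulting I E A J a \<in> S}"
proof (rule closed_subspace_vimage[OF normed_space_multilinear _ _ _ _ vnorm_resulting_le[OF J a] S])
  show "normed_space (multilinear_space (I - J) E F)"
    by (rule multilinear_setting.normed_space_multilinear[OF multilinear_setting_subset]) simp
  show "(\<lambda>A. resulting I E A J a) \<in> carrier L \<rightarrow> carrier (multilinear_space (I - J) E F)"
    using resulting_in_space[OF J a] by blast
qed (use points_override_on[OF _ a J] in \<open>simp_all add: resulting_def cong: restrict_cong\<close>)

end

section \<open>Operators that have a property strongly\<close>

theorem proposition5p3:
  fixes m :: nat
    and E :: "nat \<Rightarrow> ('k::real_normed_field, 'a) normed_module"
    and F :: "('k, 'b) normed_module"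
    and P :: "nat set \<Rightarrow> ((nat \<Rightarrow> 'a) \<Rightarrow> 'b) \<Rightarrow> bool"
  assumes "1 \<le> m"
    and "\<And>i. i \<in> {1..m} \<Longrightarrow> banach_space (E i)"
    and "banach_space F"
    and "\<And>J. J \<subset> {1..m} \<Longrightarrow>
      closed_subspace (multilinear_space ({1..m} - J) E F)
        {B \<in> carrier (multilinear_space ({1..m} - J) E F). P J B}"
  shows "closed_subspace (multilinear_space {1..m} E F)
    {A \<in> carrier (multilinear_space {1..m} E F). has_strongly {1..m} E P A}"
proof -
  interpret multilinear_setting "{1..m}" E F
    by (intro multilinear_setting.intro multilinear_setting_axioms.intro
        banach_space.axioms(1) assms(2,3)) simp_all
  let ?B = "\<lambda>J. {B \<in> carrier (multilinear_space ({1..m} - J) E F). P J B}"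
  define \<S> where "\<S> = {{A \<in> carrier L. resulting {1..m} E A J a \<in> ?B J} |J a.
    J \<subset> {1..m} \<and> a \<in> points J E}"
  have mem: "{A \<in> carrier L. resulting {1..m} E A J a \<in> ?B J} \<in> \<S>"
    if "J \<subset> {1..m}" "a \<in> points J E" for J a
    unfolding \<S>_def using that by blast
  have in_B: "resulting {1..m} E A J a \<in> ?B J \<longleftrightarrow> P J (resulting {1..m} E A J a)"
    if "J \<subset> {1..m}" "a \<in> points J E" "A \<in> carrier L" for J a A
    using resulting_in_space[of J a A] that by blast
  \<comment> \<open>Fixing no variable is one of the allowed choices because \<open>m\<close> is positive; \<open>\<lambda>_. undefined\<close> is the
    only point of the empty product.\<close>
  have "{} \<subset> {1..m}" and "(\<lambda>_. undefined) \<in> points {} E"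
    using assms(1) by (auto simp: points_def)
  from mem[OF this] have ne: "\<S> \<noteq> {}"
    by blast
  have "closed_subspace L (\<Inter>\<S>)"
  proof (rule closed_subspace_Inter[OF normed_space_multilinear ne])
    fix S assume "S \<in> \<S>"
    then obtain J a where "J \<subset> {1..m}" "a \<in> points J E"
      and S: "S = {A \<in> carrier L. resulting {1..m} E A J a \<in> ?B J}"
      unfolding \<S>_def by blast
    then show "closed_subspace L S"
      unfolding S by (intro closed_subspace_resulting assms(4)) auto
  qed
  moreover have "\<Inter>\<S> = {A \<in> carrier L. has_strongly {1..m} E P A}"
  proof (intro equalityI subsetI)
    fix A assume A: "A \<in> \<Inter>\<S>"
    then have AL: "A \<in> carrier L"
      using ne unfolding \<S>_def by blast
    have "P J (resulting {1..m} E A J a)" if "J \<subset> {1..m}" "a \<in> points J E" for J a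
      using A mem[OF that] in_B[OF that AL] by blast
    then show "A \<in> {A \<in> carrier L. has_strongly {1..m} E P A}"
      using AL unfolding has_strongly_def by blast
  next
    fix A assume "A \<in> {A \<in> carrier L. has_strongly {1..m} E P A}"
    then show "A \<in> \<Inter>\<S>"
      using in_B unfolding \<S>_def has_strongly_def by blast
  qed
  ultimately show ?thesis
    by simp
qed

end
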